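(* Let $$\mathcal{D}_{\mathrm{all}}=\{(a,p)\in\mathbb{Z}_{>0}^2: p\text{ is prime and }p<a\},\qquad \mathcal{D}_{\mathrm{pp}}=\{(a,p)\in\mathbb{Z}_{>0}^2: a,p\text{ are prime and }2<p<a\}.$$ There is no nonzero polynomial $F\in\mathbb{C}[X_1,X_2,X_3]$ such that $F\bigl(a,p,G(a,p)\bigr)=0$ for every $(a,p)\in\mathcal{D}_{\mathrm{all}}$. In fact, the same conclusion holds with $\mathcal{D}_{\mathrm{all}}$ replaced by $\mathcal{D}_{\mathrm{pp}}$: there is no nonzero polynomial $F\in\mathbb{C}[X_1,X_2,X_3]$ such that $F\bigl(a,p,G(a,p)\bigr)=0$ for every $(a,p)\in\mathcal{D}_{\mathrm{pp}}$.
   Context: $\mathbb{N}$ denotes the non-negative integers and $\mathbb{Z}_{>0}$ the positive integers. For $a\ge 2$, $\langle a,a+1\rangle=\{xa+y(a+1):x,y\in\mathbb{N}\}$. For $S\subseteq\mathbb{N}$ a numerical semigroup (contains $0$, closed under addition, finite complement) and $p\in\mathbb{Z}_{>0}$, $\frac{S}{p}=\{n\in\mathbb{N}:pn\in S\}$; for $S\ne\mathbb{N}$ the Frobenius number is $g(S)=\max(\mathbb{N}\setminus S)$. Set $G(a,p)=g\!\left(\frac{\langle a,a+1\rangle}{p}\right)$. *)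

theory Defs
  imports "HOL-Analysis.Analysis" "HOL-Library.Poly_Mapping"
    "HOL-Computational_Algebra.Primes"
begin

definition numerical_semigroup :: "nat set \<Rightarrow> bool" where
  "numerical_semigroup S \<longleftrightarrow>
     0 \<in> S \<and> (\<forall>m\<in>S. \<forall>n\<in>S. m + n \<in> S) \<and> finite (UNIV - S)"

definition consecutive_semigroup :: "nat \<Rightarrow> nat set" where
  "consecutive_semigroup a = {x * a + y * (a + 1) | x y. True}"

definition semigroup_quotient :: "nat set \<Rightarrow> nat \<Rightarrow> nat set" where
  "semigroup_quotient S p = {n. p * n \<in> S}"

text \<open>Meaningful only for a numerical semigroup other than \<open>UNIV\<close>; otherwise the maximum is
  taken over an empty or infinite set.\<close>
definition frobenius_number :: "nat set \<Rightarrow> nat" where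
  "frobenius_number S = Max (UNIV - S)"

definition G :: "nat \<Rightarrow> nat \<Rightarrow> nat" where
  "G a p = frobenius_number (semigroup_quotient (consecutive_semigroup a) p)"

definition D_all :: "(nat \<times> nat) set" where
  "D_all = {(a, p). 0 < a \<and> 0 < p \<and> prime p \<and> p < a}"

definition D_pp :: "(nat \<times> nat) set" where
  "D_pp = {(a, p). 0 < a \<and> 0 < p \<and> prime a \<and> prime p \<and> 2 < p \<and> p < a}"

text \<open>A polynomial in \<open>X\<^sub>1, X\<^sub>2, X\<^sub>3\<close> is a finitely supported family of coefficients indexed by
  monomials; a monomial is its exponent vector, indexed by the three-element type \<open>3\<close>
  (whose elements are \<open>1\<close>, \<open>2\<close> and \<open>3 = 0\<close>).\<close>
type_synonym 'a poly3 = "(3 \<Rightarrow>\<^sub>0 nat) \<Rightarrow>\<^sub>0 'a"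

definition eval_poly3 :: "'a::comm_semiring_1 poly3 \<Rightarrow> 'a ^ 3 \<Rightarrow> 'a" where
  "eval_poly3 F x =
     (\<Sum>m\<in>Poly_Mapping.keys F. Poly_Mapping.lookup F m * (\<Prod>i\<in>UNIV. (x $ i) ^ Poly_Mapping.lookup m i))"

text \<open>The quotients below are numerical semigroups other than \<open>UNIV\<close> on both index sets, so
  \<open>G\<close> is there the Frobenius number in the proper sense.\<close>

lemma consecutive_semigroup_large:
  assumes "0 < a" "a * a \<le> n"
  shows "n \<in> consecutive_semigroup a"
proof -
  have "n mod a < a" using assms(1) by simp
  moreover have "a \<le> n div a" using assms by (simp add: less_eq_div_iff_mult_less_eq)
  ultimately have le: "n mod a \<le> n div a" by simp
  have "(n div a - n mod a) * a + (n mod a) * (a + 1)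
      = ((n div a - n mod a) + n mod a) * a + n mod a"
    by (simp add: algebra_simps)
  also have "\<dots> = n" using le by simp
  finally show ?thesis unfolding consecutive_semigroup_def by (smt (verit) mem_Collect_eq)
qed

lemma numerical_semigroup_quotient:
  assumes "0 < a" "0 < p"
  shows "numerical_semigroup (semigroup_quotient (consecutive_semigroup a) p)"
  unfolding numerical_semigroup_def
proof (intro conjI ballI)
  show "0 \<in> semigroup_quotient (consecutive_semigroup a) p"
    by (auto simp: semigroup_quotient_def consecutive_semigroup_def)
next
  fix m n
  assume "m \<in> semigroup_quotient (consecutive_semigroup a) p"
    and "n \<in> semigroup_quotient (consecutive_semigroup a) p"
  then obtain x y x' y' where "p * m = x * a + y * (a + 1)" "p * n = x' * a + y' * (a + 1)"
    by (auto simp: semigroup_quotient_def consecutive_semigroup_def)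
  then have "p * (m + n) = (x + x') * a + (y + y') * (a + 1)"
    by (simp add: algebra_simps)
  then show "m + n \<in> semigroup_quotient (consecutive_semigroup a) p"
    unfolding semigroup_quotient_def consecutive_semigroup_def by blast
next
  have "UNIV - semigroup_quotient (consecutive_semigroup a) p \<subseteq> {..<a * a}"
  proof
    fix n assume n: "n \<in> UNIV - semigroup_quotient (consecutive_semigroup a) p"
    have "p * n < a * a"
      using n consecutive_semigroup_large[OF assms(1), of "p * n"]
      by (force simp: semigroup_quotient_def)
    moreover have "n \<le> p * n" using assms(2) by (cases p) auto
    ultimately have "n < a * a" by linarith
    then show "n \<in> {..<a * a}" by simp
  qed
  then show "finite (UNIV - semigroup_quotient (consecutive_semigroup a) p)"
    by (rule finite_subset) simp
qed

lemma semigroup_quotient_neq_UNIV: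
  assumes "0 < p" "p < a"
  shows "semigroup_quotient (consecutive_semigroup a) p \<noteq> UNIV"
proof
  assume "semigroup_quotient (consecutive_semigroup a) p = UNIV"
  then have "1 \<in> semigroup_quotient (consecutive_semigroup a) p" by simp
  then obtain x y where xy: "p = x * a + y * (a + 1)"
    by (auto simp: semigroup_quotient_def consecutive_semigroup_def)
  with assms(1) have "1 \<le> x + y" by (cases x) auto
  then have "a \<le> (x + y) * a" by simp
  also have "\<dots> \<le> p" using xy by (simp add: algebra_simps)
  finally show False using assms(2) by simp
qed

end

theory Submission
  imports Defs "HOL-Real_Asymp.Real_Asymp"
begin

text \<open>Locating the last gap of \<open>\<langle>a, a + 1\<rangle>\<close> that contains a multiple of \<open>p\<close> gives
  \<open>p G(a, p) = a\<^sup>2 - t a - s\<close> with \<open>1 \<le> t, s \<le> p\<close>. Suppose \<open>F\<close> vanishes on all prime pairs.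
  If for a fixed large \<open>p\<close> many \<open>a\<close> share the same \<open>(t, s)\<close>, then \<open>F(X, p, (X\<^sup>2 - t X - s) / p)\<close>
  is identically zero, so \<open>(X\<^sup>2 - t X - s) / p\<close> is a root of the nonzero polynomial \<open>F(X, p, Z)\<close> in \<open>Z\<close>
  over \<open>\<complex>[X]\<close>; the number of such \<open>(t, s)\<close> is bounded independently of \<open>p\<close>, and each one
  determines \<open>a\<close> modulo \<open>p\<close> up to two choices, the roots of \<open>c\<^sup>2 - t c - s\<close>. Hence, for
  every prime \<open>p\<close> in a range \<open>(P\<^sub>0, y]\<close>, a fixed proportion of a set of \<open>O(y\<^sup>3)\<close> primes
  below a fixed power of \<open>y\<close> lies in one residue class modulo \<open>p\<close>. This contradicts
  Gallagher's larger sieve, which replaces Dirichlet's theorem here; the only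
  input on the distribution of primes is a weak Chebyshev lower bound.\<close>

section \<open>Membership in the semigroup and the shape of \<open>G a p\<close>\<close>

text \<open>The sums of exactly \<open>k\<close> generators fill the interval from
  \<open>k * a\<close> to \<open>k * a + k\<close>.\<close>

lemma consecutive_semigroup_iff:
  assumes "0 < a"
  shows "n \<in> consecutive_semigroup a \<longleftrightarrow> n mod a \<le> n div a"
proof
  assume "n \<in> consecutive_semigroup a"
  then obtain x y where n: "n = x * a + y * (a + 1)"
    by (auto simp: consecutive_semigroup_def)
  have n': "n = y + (x + y) * a" using n by (simp add: algebra_simps)
  have "n div a = x + y + y div a" "n mod a = y mod a"
    using assms by (simp_all add: n')
  then show "n mod a \<le> n div a"
    using mod_less_eq_dividend[of y a] by linarith
next
  assume le: "n mod a \<le> n div a"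
  have "(n div a - n mod a) * a + (n mod a) * (a + 1)
      = ((n div a - n mod a) + n mod a) * a + n mod a"
    by (simp add: algebra_simps)
  also have "\<dots> = n" using le by simp
  finally have "n = (n div a - n mod a) * a + (n mod a) * (a + 1)" ..
  then show "n \<in> consecutive_semigroup a"
    unfolding consecutive_semigroup_def by blast
qed

text \<open>If \<open>q\<close> and \<open>r\<close> are the quotient and remainder of
  \<open>p * G a p\<close> by \<open>a\<close>, then \<open>t = a - 1 - q\<close> and
  \<open>s = a - r\<close>. Being a gap means \<open>q < r\<close>, hence
  \<open>1 \<le> s \<le> t\<close>; maximality of the gap gives \<open>t \<le> p\<close>.\<close>

lemma G_representation:
  assumes "0 < p" "p < a"
  obtains t s where "t \<in> {1..p}" "s \<in> {1..p}" "p * G a p + t * a + s = a * a"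
proof -
  have a: "0 < a" using assms by simp
  define Q where "Q = semigroup_quotient (consecutive_semigroup a) p"
  have gap: "n \<in> UNIV - Q \<longleftrightarrow> (p * n) div a < (p * n) mod a" for n
    by (auto simp: Q_def semigroup_quotient_def consecutive_semigroup_iff[OF a])
  have fin: "finite (UNIV - Q)"
    using numerical_semigroup_quotient[OF a assms(1)]
    by (simp add: numerical_semigroup_def Q_def)
  have ne: "UNIV - Q \<noteq> {}"
    using semigroup_quotient_neq_UNIV[OF assms] by (auto simp: Q_def)
  have G: "G a p = Max (UNIV - Q)" by (simp add: G_def frobenius_number_def Q_def)
  \<comment> \<open>The largest multiple of \<open>p\<close> below \<open>(a - p) a\<close> is a gap, which yields \<open>t \<le> p\<close>.\<close>
  define n0 where "n0 = ((a - p) * a - 1) div p"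
  define r0 where "r0 = ((a - p) * a - 1) mod p"
  have pos: "1 \<le> (a - p) * a" using assms by simp
  have n0: "p * n0 + r0 + 1 = (a - p) * a"
  proof -
    have "p * n0 + r0 = (a - p) * a - 1" by (simp add: n0_def r0_def)
    then show ?thesis using pos by linarith
  qed
  have r0: "r0 < p" using assms by (simp add: r0_def)
  have ap: "(a - p) * a = (a - p - 1) * a + a"
    using assms by (metis Suc_diff_1 Suc_diff_Suc add.commute diff_Suc_eq_diff_pred diff_Suc_1 mult_Suc)
  have n0': "p * n0 = (a - 1 - r0) + (a - p - 1) * a" using n0 ap r0 assms by linarith
  have "(p * n0) div a = a - p - 1" "(p * n0) mod a = a - 1 - r0"
    using a assms by (simp_all add: n0')
  then have "n0 \<in> UNIV - Q" using gap r0 assms by simp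
  then have ge: "n0 \<le> G a p" using fin by (simp add: G)
  define q r where "q = (p * G a p) div a" and "r = (p * G a p) mod a"
  have qr: "p * G a p = q * a + r" by (simp add: q_def r_def)
  have "G a p \<in> UNIV - Q" unfolding G using fin ne by (rule Max_in)
  then have "q < r" by (simp only: gap q_def r_def)
  have "r < a" using a by (simp add: r_def)
  have "p * n0 div a \<le> q" unfolding q_def using ge by (intro div_le_mono mult_le_mono2)
  then have q: "a - p - 1 \<le> q" using \<open>(p * n0) div a = a - p - 1\<close> by simp
  show ?thesis
  proof (rule that)
    show "a - 1 - q \<in> {1..p}" "a - r \<in> {1..p}"
      using q \<open>q < r\<close> \<open>r < a\<close> by auto
    have "(q + (a - 1 - q) + 1) * a = a * a" using \<open>q < r\<close> \<open>r < a\<close> by simp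
    then show "p * G a p + (a - 1 - q) * a + (a - r) = a * a"
      using \<open>r < a\<close> unfolding qr add_mult_distrib by linarith
  qed
qed

section \<open>A weak Chebyshev lower bound\<close>

text \<open>The witness is the least common multiple of \<open>1, ..., N\<close>, written as a
  product over the primes up to \<open>N\<close> of their largest powers not exceeding
  \<open>N\<close>.\<close>

lemma common_multiple_power_bound:
  obtains L :: nat where "L > 0" "\<And>k. k \<in> {1..N} \<Longrightarrow> k dvd L"
    "L \<le> N ^ card {p. prime p \<and> p \<le> N}"
proof -
  define P where "P = {p::nat. prime p \<and> p \<le> N}"
  have finP: "finite P" by (simp add: P_def)
  define e where "e p = (GREATEST e. p ^ e \<le> N)" for p
  \<comment> \<open>Bounded exponents make the \<open>GREATEST\<close> in \<open>e\<close> an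
    attained maximum.\<close>
  have bound: "i \<le> N" if "p \<in> P" "p ^ i \<le> N" for p i
  proof -
    have "2 \<le> p" using that(1) by (auto simp: P_def prime_ge_2_nat)
    then have "2 ^ i \<le> p ^ i" by (rule power_mono) simp
    then show ?thesis using that(2) less_exp[of i] by linarith
  qed
  have e1: "p ^ e p \<le> N" if "p \<in> P" for p
    unfolding e_def
  proof (rule GreatestI_nat[where k = 0 and b = N and P = "\<lambda>e. p ^ e \<le> N"])
    have "0 < p" "p \<le> N" using that by (auto simp: P_def prime_gt_0_nat)
    then show "p ^ 0 \<le> N" by simp
  qed (use bound that in blast)
  have e2: "i \<le> e p" if "p \<in> P" "p ^ i \<le> N" for p i
    unfolding e_def using Greatest_le_nat[where b = N and P = "\<lambda>e. p ^ e \<le> N"] bound that by blast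
  define L where "L = (\<Prod>p\<in>P. p ^ e p)"
  show ?thesis
  proof (rule that)
    show "L > 0" unfolding L_def by (intro prod_pos) (auto simp: P_def prime_gt_0_nat)
    have "L \<le> (\<Prod>p\<in>P. N)" unfolding L_def by (intro prod_mono) (simp add: e1)
    then show "L \<le> N ^ card {p. prime p \<and> p \<le> N}" by (simp add: P_def)
    fix k assume k: "k \<in> {1..N}"
    have "k = (\<Prod>p\<in>prime_factors k. p ^ multiplicity p k)"
      using k prime_factorization_nat[of k] by simp
    also have "\<dots> dvd L" unfolding L_def
    proof (rule prod_dvd_prod_subset2[OF finP])
      have le: "p \<le> N" if "p \<in> prime_factors k" for p
        using that k by (meson atLeastAtMost_iff dvd_imp_le in_prime_factors_imp_dvd le_trans less_le_trans zero_less_one)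
      then show "prime_factors k \<subseteq> P" by (auto simp: P_def)
      fix p assume p: "p \<in> prime_factors k"
      have "p ^ multiplicity p k dvd k" by (rule multiplicity_dvd)
      then have "p ^ multiplicity p k \<le> N" using k dvd_imp_le[of _ k] by fastforce
      then have "multiplicity p k \<le> e p" using e2 le p by (auto simp: P_def)
      then show "p ^ multiplicity p k dvd p ^ e p" by (rule le_imp_power_dvd)
    qed
    finally show "k dvd L" .
  qed
qed

text \<open>\<open>m! k! / (m + k + 1)!\<close> is the beta integral of \<open>x\<^sup>m (1 - x)\<^sup>k\<close> over \<open>[0, 1]\<close>; the induction
  uses \<open>x\<^sup>m (1 - x)\<^sup>k - x\<^bsup>m + 1\<^esup> (1 - x)\<^sup>k = x\<^sup>m (1 - x)\<^bsup>k + 1\<^esup>\<close>.\<close>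
lemma beta_common_denominator:
  assumes "\<And>k. k \<in> {1..N} \<Longrightarrow> k dvd L" "m + k + 1 \<le> N"
  shows "real L * (fact m * fact k / fact (m + k + 1)) \<in> \<int>"
  using assms(2)
proof (induction k arbitrary: m)
  case 0
  then have "m + 1 dvd L" using assms(1) by simp
  then obtain c where "L = (m + 1) * c" ..
  then have L: "real L = (real m + 1) * real c" by (simp only: of_nat_mult of_nat_add of_nat_1)
  have f: "fact (m + 0 + 1) = (real m + 1) * fact m" by (simp add: algebra_simps)
  have "real m + 1 \<noteq> 0" "fact m \<noteq> (0::real)" by (auto simp: add_eq_0_iff)
  then have "(real m + 1) * real c * (fact m * 1 / ((real m + 1) * fact m)) = real c"
    by (simp only: mult_1_right divide_simps) simp
  then have "real L * (fact m * fact 0 / fact (m + 0 + 1)) = real c"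
    by (simp only: L f fact_0)
  then show ?case by simp
next
  case (Suc k)
  have "real L * (fact m * fact k / fact (m + k + 1)) \<in> \<int>"
    "real L * (fact (Suc m) * fact k / fact (Suc m + k + 1)) \<in> \<int>"
    by (rule Suc.IH, use Suc.prems in simp)+
  then have "real L * (fact m * fact k / fact (m + k + 1)) -
      real L * (fact (Suc m) * fact k / fact (Suc m + k + 1)) \<in> \<int>"
    by (rule Ints_diff)
  also have "real L * (fact m * fact k / fact (m + k + 1)) -
      real L * (fact (Suc m) * fact k / fact (Suc m + k + 1)) =
      real L * (fact m * fact (Suc k) / fact (m + Suc k + 1))"
  proof -
    have "real m + real k + 2 \<noteq> 0" by linarith
    then show ?thesis by (simp add: divide_simps) (simp add: algebra_simps)
  qed
  finally show ?case .
qed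

text \<open>At \<open>m = k = n\<close> the beta integral is therefore at most
  \<open>1 / 2 ^ n\<close>.\<close>

lemma fact_double_ge: "2 ^ n * (fact n * fact n) \<le> (fact (2 * n + 1) :: nat)"
proof (induction n)
  case (Suc n)
  have "2 ^ Suc n * (fact (Suc n) * fact (Suc n))
      = (2 * (n + 1) * (n + 1)) * (2 ^ n * (fact n * fact n) :: nat)"
    by (simp add: algebra_simps)
  also have "\<dots> \<le> ((2 * n + 3) * (2 * n + 2)) * fact (2 * n + 1)"
    by (intro mult_mono Suc.IH) (auto simp: algebra_simps)
  also have "\<dots> = fact (2 * Suc n + 1)" by (simp add: algebra_simps)
  finally show ?case .
qed simp

text \<open>Nair's argument: \<open>L\<close> times the beta integral is a positive integer, hence
  at least 1, which forces \<open>2 ^ n \<le> L\<close>.\<close>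

lemma chebyshev_lower_bound:
  "2 ^ n \<le> (2 * n + 1) ^ card {p::nat. prime p \<and> p \<le> 2 * n + 1}"
proof -
  obtain L :: nat where L: "L > 0" "\<And>k. k \<in> {1..2 * n + 1} \<Longrightarrow> k dvd L"
    "L \<le> (2 * n + 1) ^ card {p. prime p \<and> p \<le> 2 * n + 1}"
    using common_multiple_power_bound by blast
  have int: "real L * (fact n * fact n / fact (n + n + 1)) \<in> \<int>"
    by (rule beta_common_denominator[OF L(2)]) auto
  have "real L * (fact n * fact n / fact (n + n + 1)) > 0" using L(1) by simp
  with int have "real L * (fact n * fact n / fact (n + n + 1)) \<ge> 1"
    using Ints_nonzero_abs_ge1 by fastforce
  then have "1 \<le> real L * (fact n * fact n) / fact (n + n + 1)" by simp
  then have "fact (n + n + 1) \<le> real L * (fact n * fact n)"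
    by (subst (asm) pos_le_divide_eq) simp_all
  then have "real (fact (2 * n + 1)) \<le> real (L * (fact n * fact n))"
    by (simp only: mult_2 of_nat_mult of_nat_fact)
  then have "fact (2 * n + 1) \<le> L * (fact n * fact n)" by (simp only: of_nat_le_iff)
  with fact_double_ge[of n] have "2 ^ n * (fact n * fact n) \<le> L * (fact n * fact n)"
    by linarith
  then have "2 ^ n \<le> L" by simp
  with L(3) show ?thesis by linarith
qed

text \<open>The Chebyshev bound gives about \<open>4 ^ j / (4 * j)\<close> primes; the square root
  of \<open>4 ^ j\<close> is a cruder bound free of logarithms.\<close>

lemma eventually_many_primes:
  "\<forall>\<^sub>F j in sequentially. 2 ^ j \<le> card {p::nat. prime p \<and> p \<le> 4 ^ j}"
proof -
  have "\<forall>\<^sub>F j in sequentially. (2::real) ^ j * (2 * real j) + 1 < 4 ^ j / 2" by real_asymp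
  then show ?thesis using eventually_gt_at_top[of 0]
  proof eventually_elim
    case (elim j)
    \<comment> \<open>This makes \<open>2 * n + 1\<close> equal to \<open>4 ^ j - 1\<close>, the
      largest odd number below \<open>4 ^ j\<close>.\<close>
    define n where "n = (4::nat) ^ j div 2 - 1"
    define c where "c = card {p::nat. prime p \<and> p \<le> 4 ^ j}"
    have ev: "2 * ((4::nat) ^ j div 2) = 4 ^ j" using elim by (intro dvd_mult_div_cancel) simp
    have "(4::nat) ^ j \<ge> 4" using elim by (metis One_nat_def Suc_leI power_increasing power_one_right one_le_numeral)
    then have n: "2 * n + 1 \<le> 4 ^ j" "2 * n + 2 = 4 ^ j" using ev by (simp_all add: n_def)
    have "2 ^ n \<le> (2 * n + 1) ^ card {p::nat. prime p \<and> p \<le> 2 * n + 1}"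
      by (rule chebyshev_lower_bound)
    also have "\<dots> \<le> (2 * n + 1) ^ c" unfolding c_def using n
      by (intro power_increasing card_mono) auto
    also have "\<dots> \<le> (4 ^ j) ^ c" using n by (intro power_mono) auto
    also have "\<dots> = 2 ^ (2 * j * c)" by (simp add: power_mult[symmetric] flip: power_mult_distrib)
       (simp add: power_mult)
    finally have "n \<le> 2 * j * c" by simp
    then have *: "real n \<le> 2 * real j * real c" by (metis of_nat_le_iff of_nat_mult of_nat_numeral)
    have "real (2 * n + 2) = 4 ^ j" using n(2) by simp
    then have "2 ^ j * (2 * real j) < 2 * real j * real c" using elim(1) * by linarith
    then have "2 ^ j < real c" using elim by simp
    then have "real (2 ^ j) < real c" by simp
    then show ?case by (simp only: c_def of_nat_less_iff less_imp_le)
  qed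
qed

section \<open>Pigeonhole and the larger sieve\<close>

text \<open>If no fibre exceeded \<open>w\<close>, the at most \<open>K\<close> fibres larger than
  \<open>M\<close> would hold at most \<open>K * w\<close> elements and the others at most
  \<open>M * card T\<close>.\<close>

lemma large_fibre:
  assumes "finite A" "finite T" "f ` A \<subseteq> T"
    and few: "card {v \<in> T. M < card {a \<in> A. f a = v}} \<le> K"
    and large: "M * card T + K * w < card A"
  obtains v where "v \<in> T" "w < card {a \<in> A. f a = v}"
proof -
  define N where "N v = card {a \<in> A. f a = v}" for v
  have "\<exists>v\<in>T. w < N v"
  proof (rule ccontr)
    assume "\<not> (\<exists>v\<in>T. w < N v)"
    then have "N v \<le> M + (if M < N v then w else 0)" if "v \<in> T" for v
      using that by (auto simp: not_less intro: trans_le_add2)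
    then have "(\<Sum>v\<in>T. N v) \<le> (\<Sum>v\<in>T. M + (if M < N v then w else 0))"
      by (intro sum_mono)
    also have "\<dots> = M * card T + card {v \<in> T. M < N v} * w"
      using assms(2) by (simp add: sum.distrib flip: sum.inter_filter)
    also have "\<dots> \<le> M * card T + K * w" using few by (simp add: N_def)
    also have "(\<Sum>v\<in>T. N v) = card A"
    proof -
      have "A = (\<Union>v\<in>T. {a \<in> A. f a = v})" using assms(3) by auto
      then have "card A = card (\<Union>v\<in>T. {a \<in> A. f a = v})" by simp
      also have "\<dots> = (\<Sum>v\<in>T. N v)" unfolding N_def
        using assms(1,2) by (intro card_UN_disjoint) auto
      finally show ?thesis by simp
    qed
    finally show False using large by simp
  qed
  then show ?thesis using that by (auto simp: N_def)
qed

text \<open>Distinct primes are coprime, so their product divides \<open>m\<close>, and it is at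
  least \<open>2 ^ card P\<close>.\<close>

lemma card_prime_divisors_le:
  fixes m :: nat
  assumes "0 < m" "m < 2 ^ l" "\<And>p. p \<in> P \<Longrightarrow> prime p" "\<And>p. p \<in> P \<Longrightarrow> p dvd m"
  shows "card P \<le> l"
proof -
  have "P \<subseteq> prime_factors m" using assms by (auto simp: prime_factors_dvd)
  then have fin: "finite P" by (rule finite_subset) simp
  have "\<Prod>Q dvd m" if "Q \<subseteq> P" for Q
    using finite_subset[OF that fin] that
  proof (induction Q rule: finite_induct)
    case (insert q Q)
    have "coprime q (\<Prod>Q)"
      using insert assms(3) by (intro prod_coprime_right primes_coprime) auto
    with insert assms(4) show ?case by (auto intro: divides_mult)
  qed simp
  then have "\<Prod>P dvd m" by simp
  then have "\<Prod>P \<le> m" using assms(1) by (rule dvd_imp_le)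
  moreover have "2 ^ card P \<le> \<Prod>P"
    using prod_mono[of P "\<lambda>_. 2" "\<lambda>p. p"] assms(3) by (auto simp: prime_ge_2_nat)
  ultimately have "(2::nat) ^ card P < 2 ^ l" using assms(2) by linarith
  then show ?thesis by simp
qed

lemma card_filter_eq_sum:
  assumes "finite S"
  shows "card {x \<in> S. Q x} = (\<Sum>x\<in>S. if Q x then 1 else 0)"
  using assms by (simp flip: sum.inter_filter)

text \<open>Double counting of the triples \<open>(p, a, b)\<close> with \<open>a \<noteq> b\<close> in \<open>A\<close> and \<open>p\<close> dividing \<open>a - b\<close>.\<close>
lemma larger_sieve:
  fixes A P :: "nat set"
  assumes fin: "finite A" "finite P" and P: "\<And>p. p \<in> P \<Longrightarrow> prime p"
    and A: "\<And>a. a \<in> A \<Longrightarrow> a < 2 ^ l"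
    and C: "\<And>p. p \<in> P \<Longrightarrow> \<exists>C\<subseteq>A. w < card C \<and> (\<forall>a\<in>C. \<forall>b\<in>C. a mod p = b mod p)"
  shows "card P * w ^ 2 \<le> card A ^ 2 * l"
proof -
  define D where "D = {z \<in> A \<times> A. fst z \<noteq> snd z}"
  have finD: "finite D" unfolding D_def using fin by auto
  define h where "h p z \<longleftrightarrow> fst z mod p = snd z mod p" for p :: nat and z :: "nat \<times> nat"
  have lower: "w ^ 2 \<le> card {z \<in> D. h p z}" if p: "p \<in> P" for p
  proof -
    obtain C where C': "C \<subseteq> A" "w < card C" "\<forall>a\<in>C. \<forall>b\<in>C. a mod p = b mod p"
      using C[OF p] by blast
    have "finite C" using C'(1) fin(1) by (rule finite_subset)
    \<comment> \<open>The right-hand side counts the ordered pairs off the diagonal of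
      \<open>C\<close>; the strict \<open>w < card C\<close> absorbs the \<open>- 1\<close>.\<close>
    have "w * w \<le> card C * (card C - 1)" using C'(2) by (intro mult_mono) auto
    also have "\<dots> = card (C \<times> C) - card C"
      by (simp add: card_cartesian_product diff_mult_distrib2)
    also have "card C = card ((\<lambda>a. (a, a)) ` C)" by (simp add: card_image inj_on_def)
    also have "card (C \<times> C) - \<dots> = card (C \<times> C - (\<lambda>a. (a, a)) ` C)"
      using \<open>finite C\<close> by (intro card_Diff_subset[symmetric]) auto
    also have "\<dots> \<le> card {z \<in> D. h p z}"
    proof (rule card_mono)
      show "C \<times> C - (\<lambda>a. (a, a)) ` C \<subseteq> {z \<in> D. h p z}"
      proof
        fix z assume z: "z \<in> C \<times> C - (\<lambda>a. (a, a)) ` C"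
        then have "fst z \<in> C" "snd z \<in> C" "fst z \<noteq> snd z" by (auto simp: prod_eq_iff)
        moreover from this have "fst z mod p = snd z mod p" using C'(3) by blast
        ultimately show "z \<in> {z \<in> D. h p z}"
          using C'(1) by (auto simp: D_def h_def mem_Times_iff)
      qed
    qed (use finD in simp)
    finally show ?thesis by (simp add: power2_eq_square)
  qed
  have upper: "card {p \<in> P. h p z} \<le> l" if z: "z \<in> D" for z
  proof -
    obtain a b where ab: "z = (a, b)" "a \<in> A" "b \<in> A" "a \<noteq> b" using z by (auto simp: D_def)
    define m where "m = max a b - min a b"
    show ?thesis
    proof (rule card_prime_divisors_le)
      show "0 < m" using ab by (auto simp: m_def)
      show "m < 2 ^ l" using A[OF ab(2)] A[OF ab(3)] by (auto simp: m_def)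
      fix p assume p: "p \<in> {p \<in> P. h p z}"
      then show "prime p" using P by simp
      have "max a b mod p = min a b mod p" using p ab by (auto simp: h_def max_def min_def)
      then show "p dvd m" unfolding m_def by (rule mod_eq_dvd_iff_nat[THEN iffD1, rotated]) simp
    qed
  qed
  have "card P * w ^ 2 \<le> (\<Sum>p\<in>P. card {z \<in> D. h p z})"
    using sum_mono[of P "\<lambda>_. w ^ 2" "\<lambda>p. card {z \<in> D. h p z}"] lower by simp
  also have "\<dots> = (\<Sum>p\<in>P. \<Sum>z\<in>D. if h p z then 1 else 0)"
    by (simp only: card_filter_eq_sum[OF finD])
  also have "\<dots> = (\<Sum>z\<in>D. \<Sum>p\<in>P. if h p z then 1 else 0)" by (rule sum.swap)
  also have "\<dots> = (\<Sum>z\<in>D. card {p \<in> P. h p z})"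
    by (simp only: card_filter_eq_sum[OF fin(2)])
  also have "\<dots> \<le> card D * l" using sum_mono[of D _ "\<lambda>_. l"] upper by simp
  also have "\<dots> \<le> card (A \<times> A) * l"
    using fin by (intro mult_right_mono card_mono) (auto simp: D_def)
  finally show ?thesis by (simp add: card_cartesian_product power2_eq_square)
qed


section \<open>Specializing the second variable of \<open>F\<close>\<close>

text \<open>\<open>F(X, y, Z)\<close> as a polynomial in \<open>Z\<close> with coefficients in \<open>'a[X]\<close>.\<close>
definition slice :: "'a::idom poly3 \<Rightarrow> 'a \<Rightarrow> 'a poly poly" where
  "slice F y = (\<Sum>m\<in>Poly_Mapping.keys F. monom (monom (Poly_Mapping.lookup F m *
     y ^ Poly_Mapping.lookup m 2) (Poly_Mapping.lookup m 1)) (Poly_Mapping.lookup m 3))"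

lemma poly_slice: "poly (poly (slice F y) q) x = eval_poly3 F (vector [x, y, poly q x])"
proof -
  have monomial: "(\<Prod>i\<in>UNIV. ((vector [x, y, z] :: 'a ^ 3) $ i) ^ Poly_Mapping.lookup m i) =
      x ^ Poly_Mapping.lookup m 1 * y ^ Poly_Mapping.lookup m 2 * z ^ Poly_Mapping.lookup m 3"
    for m :: "3 \<Rightarrow>\<^sub>0 nat" and z
    unfolding UNIV_3 by (simp add: mult.assoc)
  show ?thesis
    unfolding slice_def eval_poly3_def poly_sum poly_monom poly_mult poly_power monomial
    by (intro sum.cong refl) (simp add: mult_ac)
qed

lemma degree_slice_le:
  "degree (slice F y) \<le> (\<Sum>m\<in>Poly_Mapping.keys F. Poly_Mapping.lookup m 3)"
  unfolding slice_def
  by (intro degree_sum_le order.trans[OF degree_monom_le] member_le_sum) auto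

text \<open>The bound depends on neither \<open>y\<close> nor \<open>q\<close>, so one constant
  serves all primes \<open>p\<close> and all pairs \<open>(t, s)\<close>.\<close>

lemma degree_poly_slice_le:
  assumes "degree q \<le> 2"
  shows "degree (poly (slice F y) q) \<le>
    (\<Sum>m\<in>Poly_Mapping.keys F. Poly_Mapping.lookup m 1 + 2 * Poly_Mapping.lookup m 3)"
proof -
  have deg: "degree (monom c i * q ^ k) \<le> i + 2 * k" for c :: 'a and i k
  proof -
    have "degree (q ^ k) \<le> 2 * k"
      using degree_power_le[of q k] assms by (meson mult_le_mono1 order.trans)
    then show ?thesis
      using degree_mult_le[of "monom c i" "q ^ k"] degree_monom_le[of c i] by linarith
  qed
  have exponent: "Poly_Mapping.lookup m 1 + 2 * Poly_Mapping.lookup m 3 \<le>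
      (\<Sum>m\<in>Poly_Mapping.keys F. Poly_Mapping.lookup m 1 + 2 * Poly_Mapping.lookup m 3)"
    if "m \<in> Poly_Mapping.keys F" for m
    using that by (intro member_le_sum[where f = "\<lambda>m. Poly_Mapping.lookup m 1 + 2 * Poly_Mapping.lookup m 3"]) auto
  show ?thesis
    unfolding slice_def poly_sum poly_monom
    by (intro degree_sum_le order.trans[OF deg exponent]) auto
qed

lemma finite_slice_eq_0:
  assumes "F \<noteq> 0"
  shows "finite {y. slice F y = 0}"
proof -
  obtain n where n: "n \<in> Poly_Mapping.keys F" using assms by (metis ex_in_conv keys_eq_empty)
  \<comment> \<open>\<open>Q\<close> collects the terms of \<open>F\<close> that agree with
    \<open>n\<close> in the first and third exponents, as a polynomial in the second
    variable.\<close>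
  define Q where "Q = (\<Sum>m\<in>Poly_Mapping.keys F.
    if Poly_Mapping.lookup m 1 = Poly_Mapping.lookup n 1 \<and> Poly_Mapping.lookup m 3 = Poly_Mapping.lookup n 3
    then monom (Poly_Mapping.lookup F m) (Poly_Mapping.lookup m 2) else 0)"
  have slice: "coeff (coeff (slice F y) (Poly_Mapping.lookup n 3)) (Poly_Mapping.lookup n 1) = poly Q y" for y
    unfolding Q_def slice_def coeff_sum poly_sum
    by (intro sum.cong) (auto simp: poly_monom)
  have eq: "m = n" if "Poly_Mapping.lookup m 1 = Poly_Mapping.lookup n 1"
     "Poly_Mapping.lookup m 2 = Poly_Mapping.lookup n 2" "Poly_Mapping.lookup m 3 = Poly_Mapping.lookup n 3" for m
  proof (rule poly_mapping_eqI)
    fix i :: 3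
    show "Poly_Mapping.lookup m i = Poly_Mapping.lookup n i"
      using exhaust_3[of i] that by auto
  qed
  have "coeff Q (Poly_Mapping.lookup n 2) = (\<Sum>m\<in>Poly_Mapping.keys F.
      if m = n then Poly_Mapping.lookup F m else 0)"
    unfolding Q_def coeff_sum using eq by (intro sum.cong) auto
  also have "\<dots> = Poly_Mapping.lookup F n" using n by simp
  also have "\<dots> \<noteq> 0" using n by (simp add: in_keys_iff)
  finally have "Q \<noteq> 0" by auto
  then have "finite {y. poly Q y = 0}" by (rule poly_roots_finite)
  moreover have "{y. slice F y = 0} \<subseteq> {y. poly Q y = 0}" using slice by (metis (mono_tags, lifting) Collect_mono coeff_0)
  ultimately show ?thesis by (rule rev_finite_subset)
qed


section \<open>Vanishing forces concentration in a residue class\<close>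

lemma card_quadratic_residues_le:
  fixes p :: nat
  assumes "prime p" and quad: "\<And>a. a \<in> A \<Longrightarrow> \<exists>g. p * g + t * a + s = a * a"
  shows "card ((\<lambda>a. a mod p) ` A) \<le> 2"
proof (cases "A = {}")
  case False
  then obtain b where b: "b \<in> A" by blast
  \<comment> \<open>The two roots of \<open>c\<^sup>2 - t c - s\<close> modulo \<open>p\<close> have sum \<open>t\<close>.\<close>
  have "(\<lambda>a. a mod p) ` A \<subseteq> {b mod p, nat ((int t - int b) mod int p)}"
  proof (rule image_subsetI)
    fix a assume a: "a \<in> A"
    obtain g h where "p * g + t * a + s = a * a" "p * h + t * b + s = b * b"
      using quad[OF a] quad[OF b] by blast
    then have "int (p * g + t * a + s) = int (a * a)" "int (p * h + t * b + s) = int (b * b)"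
      by simp_all
    then have "(int a - int b) * (int a - (int t - int b)) = int p * (int g - int h)"
      by (simp add: algebra_simps)
    then have "int p dvd (int a - int b) * (int a - (int t - int b))" by simp
    then have "int p dvd int a - int b \<or> int p dvd int a - (int t - int b)"
      using assms(1) by (simp add: prime_dvd_mult_iff)
    then have "int a mod int p = int b mod int p \<or> int a mod int p = (int t - int b) mod int p"
      by (simp only: mod_eq_dvd_iff)
    then have "a mod p = b mod p \<or> a mod p = nat ((int t - int b) mod int p)"
      by (metis nat_int zmod_int)
    then show "a mod p \<in> {b mod p, nat ((int t - int b) mod int p)}" by simp
  qed
  then have "card ((\<lambda>a. a mod p) ` A) \<le> card {b mod p, nat ((int t - int b) mod int p)}"
    by (intro card_mono) auto
  also have "\<dots> \<le> 2" by (simp add: card_insert_if)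
  finally show ?thesis .
qed simp

text \<open>The constants depend on \<open>F\<close> alone: beyond \<open>P0\<close> no slice
  vanishes, \<open>M\<close> bounds the degree in \<open>X\<close> after substitution, and
  \<open>K\<close> is twice a bound for the degree in \<open>Z\<close>, for two residues per
  root.\<close>

lemma vanishing_concentrates:
  fixes F :: "'a::field_char_0 poly3"
  assumes "F \<noteq> 0"
  obtains K M P0 where "\<And>p A w. prime p \<Longrightarrow> P0 < p \<Longrightarrow> finite A \<Longrightarrow>
    (\<And>a. a \<in> A \<Longrightarrow> p < a \<and> eval_poly3 F (vector [of_nat a, of_nat p, of_nat (G a p)]) = 0) \<Longrightarrow>
    M * p ^ 3 + K * w < card A \<Longrightarrow>
    \<exists>C\<subseteq>A. w < card C \<and> (\<forall>a\<in>C. \<forall>b\<in>C. a mod p = b mod p)"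
proof -
  define d where "d = (\<Sum>m\<in>Poly_Mapping.keys F. Poly_Mapping.lookup m 3)"
  define M where
    "M = (\<Sum>m\<in>Poly_Mapping.keys F. Poly_Mapping.lookup m 1 + 2 * Poly_Mapping.lookup m 3)"
  have "finite ((of_nat :: nat \<Rightarrow> 'a) -` {y. slice F y = 0})"
    by (intro finite_vimageI finite_slice_eq_0 assms) (simp add: inj_def)
  then obtain P0 where P0: "\<And>p. slice F (of_nat p) = 0 \<Longrightarrow> p \<le> P0"
    by (auto simp: finite_nat_set_iff_bounded_le)
  show ?thesis
  proof (rule that[of P0 M "2 * d"])
    fix p A w
    assume p: "prime p" "P0 < p" and fin: "finite A"
      and A: "\<And>a. a \<in> A \<Longrightarrow> p < a \<and> eval_poly3 F (vector [of_nat a, of_nat p, of_nat (G a p)]) = 0"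
      and large: "M * p ^ 3 + 2 * d * w < card A"
    have "p > 0" using p by (simp add: prime_gt_0_nat)
    have "\<exists>u. fst u \<in> {1..p} \<and> snd u \<in> {1..p} \<and> p * G a p + fst u * a + snd u = a * a"
      if "a \<in> A" for a
      using G_representation[OF \<open>p > 0\<close>, of a] A[OF that] by (metis fst_conv snd_conv)
    then obtain u where u: "\<And>a. a \<in> A \<Longrightarrow> fst (u a) \<in> {1..p}" "\<And>a. a \<in> A \<Longrightarrow> snd (u a) \<in> {1..p}"
      "\<And>a. a \<in> A \<Longrightarrow> p * G a p + fst (u a) * a + snd (u a) = a * a"
      by metis
    \<comment> \<open>A fibre of \<open>f\<close> fixes \<open>(t, s)\<close> and the residue modulo
      \<open>p\<close>, which leaves \<open>p ^ 3\<close> possible values.\<close>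
    define f where "f a = (u a, a mod p)" for a
    define T where "T = ({1..p} \<times> {1..p}) \<times> {..<p}"
    define V where "V = {v \<in> T. M < card {a \<in> A. f a = v}}"
    have finT: "finite T" and cardT: "card T = p ^ 3"
      by (auto simp: T_def card_cartesian_product power3_eq_cube)
    have fT: "f ` A \<subseteq> T"
    proof (rule image_subsetI)
      fix a assume "a \<in> A"
      then show "f a \<in> T" using u(1,2)[of a] \<open>p > 0\<close> by (simp add: f_def T_def mem_Times_iff)
    qed
    \<comment> \<open>\<open>q (t, s)\<close> is \<open>(X\<^sup>2 - t X - s) / p\<close>, which
      takes the value \<open>G a p\<close> at every \<open>a\<close> with
      \<open>u a = (t, s)\<close>.\<close>
    define q :: "nat \<times> nat \<Rightarrow> 'a poly" where
      "q v = [:- of_nat (snd v) / of_nat p, - of_nat (fst v) / of_nat p, 1 / of_nat p:]" for v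
    have inj: "inj q"
      using \<open>p > 0\<close> by (auto simp: inj_def q_def prod_eq_iff)
    have "degree (q v) \<le> 2" for v by (simp add: q_def)
    then have deg: "degree (poly (slice F (of_nat p)) (q v)) \<le> M" for v
      unfolding M_def by (rule degree_poly_slice_le)
    have q_eval: "poly (q (u a)) (of_nat a) = of_nat (G a p)" if "a \<in> A" for a
    proof -
      have "of_nat (p * G a p + fst (u a) * a + snd (u a)) = (of_nat (a * a) :: 'a)"
        using u(3)[OF that] by simp
      then have "of_nat a * of_nat a - of_nat (fst (u a)) * of_nat a - of_nat (snd (u a)) =
          of_nat p * (of_nat (G a p) :: 'a)"
        by (simp add: algebra_simps)
      moreover have "poly (q (u a)) (of_nat a) = (of_nat a * of_nat a -
          of_nat (fst (u a)) * of_nat a - of_nat (snd (u a))) / of_nat p"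
        using \<open>p > 0\<close> by (simp add: q_def divide_simps) (simp add: algebra_simps)
      ultimately show ?thesis using \<open>p > 0\<close> by simp
    qed
    \<comment> \<open>A fibre in \<open>V\<close> supplies more than \<open>M\<close> zeros to a
      polynomial of degree at most \<open>M\<close>.\<close>
    have root: "poly (slice F (of_nat p)) (q (fst v)) = 0" if v: "v \<in> V" for v
    proof (rule ccontr)
      assume nz: "poly (slice F (of_nat p)) (q (fst v)) \<noteq> 0"
      have "of_nat ` {a \<in> A. f a = v} \<subseteq> {x. poly (poly (slice F (of_nat p)) (q (fst v))) x = 0}"
        using q_eval A by (auto simp: f_def poly_slice)
      then have "card (of_nat ` {a \<in> A. f a = v} :: 'a set) \<le>
          card {x. poly (poly (slice F (of_nat p)) (q (fst v))) x = 0}"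
        by (intro card_mono poly_roots_finite nz)
      also have "\<dots> \<le> degree (poly (slice F (of_nat p)) (q (fst v)))"
        by (rule card_poly_roots_bound[OF nz])
      also have "\<dots> \<le> M" by (rule deg)
      also have "card (of_nat ` {a \<in> A. f a = v} :: 'a set) = card {a \<in> A. f a = v}"
        by (intro card_image inj_onI) simp
      finally show False using v by (simp add: V_def)
    qed
    have slice: "slice F (of_nat p) \<noteq> 0" using P0[of p] p(2) by auto
    have finV: "finite V" using finT by (simp add: V_def)
    have cardW: "card (fst ` V) \<le> d"
    proof -
      have "card (fst ` V) = card (q ` fst ` V)"
        using inj by (intro card_image[symmetric]) (auto intro: inj_on_subset)
      also have "\<dots> \<le> card {x. poly (slice F (of_nat p)) x = 0}"
        using root by (intro card_mono poly_roots_finite slice) auto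
      also have "\<dots> \<le> degree (slice F (of_nat p))" by (rule card_poly_roots_bound[OF slice])
      also have "\<dots> \<le> d" unfolding d_def by (rule degree_slice_le)
      finally show ?thesis .
    qed
    \<comment> \<open>Each \<open>v\<close> in \<open>V\<close> consists of one of at most
      \<open>d\<close> pairs and one of at most two residues, so
      \<open>card V \<le> 2 * d\<close>.\<close>
    define R where "R v = (\<lambda>a. a mod p) ` {a \<in> A. u a = v}" for v
    have "V \<subseteq> (SIGMA v:fst ` V. R v)"
    proof
      fix v assume v: "v \<in> V"
      then have "{a \<in> A. f a = v} \<noteq> {}" by (auto simp: V_def simp del: Collect_empty_eq)
      then obtain a where "a \<in> A" "f a = v" by blast
      with v show "v \<in> (SIGMA v:fst ` V. R v)" by (auto simp: f_def R_def image_iff) force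
    qed
    then have "card V \<le> card (SIGMA v:fst ` V. R v)"
      using fin finV by (intro card_mono finite_SigmaI) (auto simp: R_def)
    also have "\<dots> = (\<Sum>v\<in>fst ` V. card (R v))"
      using fin finV by (intro card_SigmaI) (auto simp: R_def)
    also have "\<dots> \<le> (\<Sum>v\<in>fst ` V. 2)"
    proof (rule sum_mono)
      fix v
      show "card (R v) \<le> 2" unfolding R_def
        using u(3) by (intro card_quadratic_residues_le[OF p(1), of _ "fst v" "snd v"]) auto
    qed
    also have "\<dots> \<le> 2 * d" using cardW by simp
    finally have "card {v \<in> T. M < card {a \<in> A. f a = v}} \<le> 2 * d" by (simp only: V_def)
    from large_fibre[OF fin finT fT this large[folded cardT]]
    obtain v where "w < card {a \<in> A. f a = v}" .
    then show "\<exists>C\<subseteq>A. w < card C \<and> (\<forall>a\<in>C. \<forall>b\<in>C. a mod p = b mod p)"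
      by (intro exI[of _ "{a \<in> A. f a = v}"]) (auto simp: f_def)
  qed
qed

section \<open>Choice of parameters and the contradiction\<close>

lemma eval_not_vanishing_on_D_pp:
  fixes F :: "'a::field_char_0 poly3"
  assumes "F \<noteq> 0"
  shows "\<exists>(a, p)\<in>D_pp. eval_poly3 F (vector [of_nat a, of_nat p, of_nat (G a p)]) \<noteq> 0"
proof (rule ccontr)
  assume contra: "\<not> ?thesis"
  have vanish: "eval_poly3 F (vector [of_nat a, of_nat p, of_nat (G a p)]) = 0"
    if "prime a" "prime p" "2 < p" "p < a" for a p
  proof -
    have "(a, p) \<in> D_pp" using that by (simp add: D_pp_def)
    then show ?thesis using contra by blast
  qed
  obtain K M P0 where conc: "\<And>p A w. prime p \<Longrightarrow> P0 < p \<Longrightarrow> finite A \<Longrightarrow>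
    (\<And>a. a \<in> A \<Longrightarrow> p < a \<and> eval_poly3 F (vector [of_nat a, of_nat p, of_nat (G a p)]) = 0) \<Longrightarrow>
    M * p ^ 3 + K * w < card A \<Longrightarrow>
    \<exists>C\<subseteq>A. w < card C \<and> (\<forall>a\<in>C. \<forall>b\<in>C. a mod p = b mod p)"
    using vanishing_concentrates[OF assms] by metis
  \<comment> \<open>The summand 1 makes \<open>M * p ^ 3 + K * y ^ 3 < c * y ^ 3\<close> strict for
    \<open>p \<le> y\<close>.\<close>
  define c where "c = M + K + 1"
  obtain j0 where j0: "\<And>j. j \<ge> j0 \<Longrightarrow> 2 ^ j \<le> card {p::nat. prime p \<and> p \<le> 4 ^ j}"
    using eventually_many_primes by (auto simp: eventually_sequentially)
  \<comment> \<open>With \<open>y = 4 ^ j\<close>, the square-root bound gives at least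
    \<open>y ^ 4\<close> primes up to \<open>y ^ 8\<close>, enough for \<open>c * y ^ 3\<close> of
    them above \<open>y\<close>. The second condition makes the primes in \<open>P\<close> outnumber
    the sieve bound \<open>c ^ 2 * (16 * j + 1)\<close>.\<close>
  have "\<forall>\<^sub>F j in sequentially. real c * (4 ^ 3) ^ j + 4 ^ j < (2 ^ 8) ^ j"
    unfolding power_numeral Num.pow.simps Num.sqr.simps by simp real_asymp
  then have "\<forall>\<^sub>F j in sequentially. real c * (4 ^ j) ^ 3 + 4 ^ j < 2 ^ (8 * j)"
    by (simp only: power_mult[symmetric] mult.commute[of _ 3])
  moreover have "\<forall>\<^sub>F j in sequentially. real c ^ 2 * real (16 * j + 1) + real P0 + 3 < 2 ^ j"
    by real_asymp
  ultimately have "\<forall>\<^sub>F j in sequentially. j \<ge> j0 \<and> real c * (4 ^ j) ^ 3 + 4 ^ j < 2 ^ (8 * j) \<and>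
      real c ^ 2 * real (16 * j + 1) + real P0 + 3 < 2 ^ j"
    using eventually_ge_at_top[of j0] by eventually_elim simp
  then obtain j where "j \<ge> j0" and "real c * (4 ^ j) ^ 3 + 4 ^ j < 2 ^ (8 * j)"
    and "real c ^ 2 * real (16 * j + 1) + real P0 + 3 < 2 ^ j"
    using eventually_happens'[OF sequentially_bot] by blast
  then have j: "j \<ge> j0" "real (c * (4 ^ j) ^ 3 + 4 ^ j) < real (2 ^ (8 * j))"
    "real (c ^ 2 * (16 * j + 1) + P0 + 3) < real (2 ^ j)" by (simp_all add: algebra_simps)
  define y where "y = (4::nat) ^ j"
  have big: "c * y ^ 3 + y < 2 ^ (8 * j)" "c ^ 2 * (16 * j + 1) + P0 + 3 < 2 ^ j"
    using j(2,3) by (simp_all only: of_nat_less_iff y_def)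
  have y: "0 < y" by (simp add: y_def)
  \<comment> \<open>The removed initial segments ensure \<open>P0 < p\<close>, \<open>2 < p\<close>
    and \<open>p \<le> y < a\<close>.\<close>
  define P where "P = {p. prime p \<and> p \<le> y} - {..P0 + 2}"
  define S where "S = {a. prime a \<and> a \<le> 4 ^ (8 * j)} - {..y}"
  have "card {p::nat. prime p \<and> p \<le> y} - card {..P0 + 2} \<le> card P"
    unfolding P_def by (rule diff_card_le_card_Diff) simp
  moreover have "2 ^ j \<le> card {p::nat. prime p \<and> p \<le> y}" using j0[OF j(1)] by (simp add: y_def)
  ultimately have cardP: "c ^ 2 * (16 * j + 1) < card P" using big(2) by simp
  have "card {a::nat. prime a \<and> a \<le> 4 ^ (8 * j)} - card {..y} \<le> card S"
    unfolding S_def by (rule diff_card_le_card_Diff) simp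
  moreover have "2 ^ (8 * j) \<le> card {p::nat. prime p \<and> p \<le> 4 ^ (8 * j)}"
    using j(1) by (intro j0) simp
  ultimately have cardS: "c * y ^ 3 \<le> card S" using big(1) by simp
  obtain A where A: "A \<subseteq> S" "card A = c * y ^ 3" "finite A"
    using obtain_subset_with_card_n[OF cardS] by metis
  have "card P * (y ^ 3) ^ 2 \<le> card A ^ 2 * (16 * j + 1)"
  \<comment> \<open>Here \<open>4 ^ (8 * j) = 2 ^ (16 * j)\<close>, and the extra 1 in the exponent
    turns \<open>\<le>\<close> into \<open><\<close>.\<close>
  proof (rule larger_sieve)
    fix a assume "a \<in> A"
    then have "a \<le> 4 ^ (8 * j)" using A(1) by (auto simp: S_def)
    also have "\<dots> = 2 ^ (2 * (8 * j))" unfolding power_mult by simp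
    also have "\<dots> < 2 ^ (16 * j + 1)" by simp
    finally show "a < 2 ^ (16 * j + 1)" .
  next
    fix p assume p: "p \<in> P"
    then have "p ^ 3 \<le> y ^ 3" by (intro power_mono) (auto simp: P_def)
    then have "M * p ^ 3 + K * y ^ 3 \<le> M * y ^ 3 + K * y ^ 3" by simp
    also have "\<dots> < card A" using y by (simp add: A(2) c_def algebra_simps)
    finally show "\<exists>C\<subseteq>A. y ^ 3 < card C \<and> (\<forall>a\<in>C. \<forall>b\<in>C. a mod p = b mod p)"
      using p A vanish by (intro conc) (auto simp: P_def S_def subset_iff)
  qed (auto simp: P_def A)
  also have "\<dots> = c ^ 2 * (16 * j + 1) * (y ^ 3) ^ 2"
    by (simp add: A(2) power_mult_distrib algebra_simps)
  finally show False using cardP y by simp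
qed

theorem theorem1p5:
  "(\<nexists>F :: complex poly3. F \<noteq> 0 \<and>
      (\<forall>(a, p)\<in>D_all. eval_poly3 F (vector [of_nat a, of_nat p, of_nat (G a p)]) = 0)) \<and>
   (\<nexists>F :: complex poly3. F \<noteq> 0 \<and>
      (\<forall>(a, p)\<in>D_pp. eval_poly3 F (vector [of_nat a, of_nat p, of_nat (G a p)]) = 0))"
proof -
  have "D_pp \<subseteq> D_all" by (auto simp: D_pp_def D_all_def)
  then show ?thesis using eval_not_vanishing_on_D_pp by fast
qed

end
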